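(* Let $n \geq 2$ be an integer and let $A$ be a finite group of even order with trivial centre. Suppose that for every prime $p \neq 2$ dividing $|A|$, the number of conjugacy classes of $A$ consisting of elements of order $p$ is less than $n$. Then the commuting graph of the wreath product $A \,\mathrm{wr}\, S_n$ is connected and has diameter at most $7$.
   Context: The commuting graph $\Gamma(G)$ of a group $G$ is the simple undirected graph whose vertices are the non-central elements of $G$, with two distinct vertices $x,y$ adjacent if and only if $xy=yx$. The distance between two vertices is the length of a shortest path between them ($\infty$ if there is none), and the diameter is the maximum distance between two vertices. $S_n$ denotes the group of all permutations of a set of size $n$. For $H \leq S_n$ the wreath product is $A \,\mathrm{wr}\, H = A^n \rtimes H$, where $H$ acts on $A^n$ by permuting the $n$ coordinates. *)

theory Defs
  imports
    "HOL-Computational_Algebra.Primes"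
    "HOL-Algebra.Sym_Groups"
    "HOL-Algebra.Product_Groups"
    "HOL-Algebra.Group_Action"
    "HOL-Algebra.Multiplicative_Group"
    "Graph_Theory.Graph_Theory"
begin

definition group_center :: "('a, 'm) monoid_scheme \<Rightarrow> 'a set" where
  "group_center G = {z \<in> carrier G. \<forall>g\<in>carrier G. z \<otimes>\<^bsub>G\<^esub> g = g \<otimes>\<^bsub>G\<^esub> z}"

text \<open>The action below is the one of \<open>group.action_by_conjugation\<close>.\<close>
definition conjugacy_classes :: "('a, 'm) monoid_scheme \<Rightarrow> 'a set set" where
  "conjugacy_classes G =
     orbits G (carrier G) (\<lambda>g. \<lambda>h\<in>carrier G. g \<otimes>\<^bsub>G\<^esub> h \<otimes>\<^bsub>G\<^esub> inv\<^bsub>G\<^esub> g)"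


section \<open>Wreath products\<close>

definition semidirect_product ::
    "('a, 'm) monoid_scheme \<Rightarrow> ('b, 'k) monoid_scheme \<Rightarrow> ('b \<Rightarrow> 'a \<Rightarrow> 'a) \<Rightarrow> ('a \<times> 'b) monoid" where
  "semidirect_product N H \<phi> =
     \<lparr>carrier = carrier N \<times> carrier H,
      mult = (\<lambda>(a, h) (b, k). (a \<otimes>\<^bsub>N\<^esub> \<phi> h b, h \<otimes>\<^bsub>H\<^esub> k)),
      one = (\<one>\<^bsub>N\<^esub>, \<one>\<^bsub>H\<^esub>)\<rparr>"

text \<open>The left action moving the entry in coordinate \<open>i\<close> to coordinate \<open>\<sigma> i\<close>.\<close>
definition permute_coords :: "nat \<Rightarrow> (nat \<Rightarrow> nat) \<Rightarrow> (nat \<Rightarrow> 'a) \<Rightarrow> (nat \<Rightarrow> 'a)" where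
  "permute_coords n \<sigma> f = (\<lambda>i\<in>{1..n}. f (Hilbert_Choice.inv \<sigma> i))"

text \<open>\<open>H\<close> is meant to be a subgroup of \<open>sym_group n\<close>, the permutations of \<open>{1..n}\<close>.\<close>
definition wreath_product ::
    "('a, 'm) monoid_scheme \<Rightarrow> nat \<Rightarrow> (nat \<Rightarrow> nat) set \<Rightarrow> ((nat \<Rightarrow> 'a) \<times> (nat \<Rightarrow> nat)) monoid" where
  "wreath_product A n H =
     semidirect_product (product_group {1..n} (\<lambda>_. A)) (sym_group n\<lparr>carrier := H\<rparr>)
       (permute_coords n)"

lemma group_semidirect_product:
  assumes N: "group N" and H: "group H"
    and closed: "\<And>h a. h \<in> carrier H \<Longrightarrow> a \<in> carrier N \<Longrightarrow> \<phi> h a \<in> carrier N"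
    and hom: "\<And>h a b. h \<in> carrier H \<Longrightarrow> a \<in> carrier N \<Longrightarrow> b \<in> carrier N
                \<Longrightarrow> \<phi> h (a \<otimes>\<^bsub>N\<^esub> b) = \<phi> h a \<otimes>\<^bsub>N\<^esub> \<phi> h b"
    and act_one: "\<And>a. a \<in> carrier N \<Longrightarrow> \<phi> \<one>\<^bsub>H\<^esub> a = a"
    and act_mult: "\<And>h k a. h \<in> carrier H \<Longrightarrow> k \<in> carrier H \<Longrightarrow> a \<in> carrier N
                \<Longrightarrow> \<phi> (h \<otimes>\<^bsub>H\<^esub> k) a = \<phi> h (\<phi> k a)"
  shows "group (semidirect_product N H \<phi>)"
proof -
  interpret N: group N by fact
  interpret H: group H by fact
  show ?thesis
  proof (rule groupI)
    show "\<one>\<^bsub>semidirect_product N H \<phi>\<^esub> \<in> carrier (semidirect_product N H \<phi>)"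
      by (simp add: semidirect_product_def)
  next
    fix x y
    assume "x \<in> carrier (semidirect_product N H \<phi>)" "y \<in> carrier (semidirect_product N H \<phi>)"
    then show "x \<otimes>\<^bsub>semidirect_product N H \<phi>\<^esub> y \<in> carrier (semidirect_product N H \<phi>)"
      by (auto simp: semidirect_product_def closed)
  next
    fix x y z
    assume "x \<in> carrier (semidirect_product N H \<phi>)" "y \<in> carrier (semidirect_product N H \<phi>)"
      "z \<in> carrier (semidirect_product N H \<phi>)"
    then show "x \<otimes>\<^bsub>semidirect_product N H \<phi>\<^esub> y \<otimes>\<^bsub>semidirect_product N H \<phi>\<^esub> z =
      x \<otimes>\<^bsub>semidirect_product N H \<phi>\<^esub> (y \<otimes>\<^bsub>semidirect_product N H \<phi>\<^esub> z)"
      by (auto simp: semidirect_product_def closed hom act_mult N.m_assoc H.m_assoc)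
  next
    fix x assume "x \<in> carrier (semidirect_product N H \<phi>)"
    moreover have "\<phi> \<one>\<^bsub>H\<^esub> a = a" if "a \<in> carrier N" for a
      using act_one that .
    ultimately show "\<one>\<^bsub>semidirect_product N H \<phi>\<^esub> \<otimes>\<^bsub>semidirect_product N H \<phi>\<^esub> x = x"
      by (auto simp: semidirect_product_def)
  next
    fix x assume x: "x \<in> carrier (semidirect_product N H \<phi>)"
    then obtain a h where ah: "x = (a, h)" "a \<in> carrier N" "h \<in> carrier H"
      by (auto simp: semidirect_product_def)
    have "\<phi> (inv\<^bsub>H\<^esub> h) (inv\<^bsub>N\<^esub> a) \<otimes>\<^bsub>N\<^esub> \<phi> (inv\<^bsub>H\<^esub> h) a = \<phi> (inv\<^bsub>H\<^esub> h) \<one>\<^bsub>N\<^esub>"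
      using ah hom[of "inv\<^bsub>H\<^esub> h" "inv\<^bsub>N\<^esub> a" a] by simp
    also have "\<dots> = \<one>\<^bsub>N\<^esub>"
      using ah hom[of "inv\<^bsub>H\<^esub> h" "\<one>\<^bsub>N\<^esub>" "\<one>\<^bsub>N\<^esub>"] closed[of "inv\<^bsub>H\<^esub> h" "\<one>\<^bsub>N\<^esub>"] by simp
    finally show "\<exists>y\<in>carrier (semidirect_product N H \<phi>).
        y \<otimes>\<^bsub>semidirect_product N H \<phi>\<^esub> x = \<one>\<^bsub>semidirect_product N H \<phi>\<^esub>"
      using ah closed
      by (intro bexI[of _ "(\<phi> (inv\<^bsub>H\<^esub> h) (inv\<^bsub>N\<^esub> a), inv\<^bsub>H\<^esub> h)"])
         (auto simp: semidirect_product_def)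
  qed
qed

lemma group_wreath_product:
  assumes A: "group A" and H: "subgroup H (sym_group n)"
  shows "group (wreath_product A n H)"
proof -
  have perm: "\<sigma> permutes {1..n}" if "\<sigma> \<in> H" for \<sigma>
    using subgroup.subset[OF H] that by (auto simp: sym_group_carrier)
  have inv_in: "Hilbert_Choice.inv \<sigma> i \<in> {1..n}" if "\<sigma> \<in> H" "i \<in> {1..n}" for \<sigma> i
    using permutes_in_image[OF permutes_inv[OF perm[OF that(1)]]] that(2) by blast
  show ?thesis
    unfolding wreath_product_def
  proof (rule group_semidirect_product, goal_cases)
    case 1 show ?case by (simp add: A)
  next
    case 2 show ?case
      using group.subgroup_imp_group[OF sym_group_is_group H] .
  next
    case (3 \<sigma> f) then show ?case
      using inv_in by (fastforce simp: permute_coords_def)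
  next
    case (4 \<sigma> f g) then show ?case
      using inv_in by (fastforce simp: permute_coords_def)
  next
    case (5 f) then show ?case
      by (auto simp: permute_coords_def sym_group_one inv_id fun_eq_iff PiE_def extensional_def)
  next
    case (6 \<sigma> \<tau> f)
    then have "Hilbert_Choice.inv (\<sigma> \<circ> \<tau>) = Hilbert_Choice.inv \<tau> \<circ> Hilbert_Choice.inv \<sigma>"
      using perm by (auto intro!: o_inv_distrib permutes_bij)
    then show ?case
      using 6 inv_in by (fastforce simp: permute_coords_def sym_group_mult)
  qed
qed


section \<open>Distance, diameter and the commuting graph\<close>

text \<open>Undirected graphs are symmetric digraphs, as everywhere in \<open>Graph_Theory\<close>; each edge is
  the pair of opposite arcs. The distance is the infimum of walk lengths, which is attained by a
  path, or \<open>\<infinity>\<close> if there is no walk.\<close>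
definition graph_dist :: "('v, 'e) pre_digraph \<Rightarrow> 'v \<Rightarrow> 'v \<Rightarrow> ereal" where
  "graph_dist G u v = wf_digraph.\<mu> G (\<lambda>_. 1) u v"

definition graph_diameter :: "('v, 'e) pre_digraph \<Rightarrow> ereal" where
  "graph_diameter G = (SUP (u, v)\<in>verts G \<times> verts G. graph_dist G u v)"

definition commuting_graph :: "('a, 'm) monoid_scheme \<Rightarrow> 'a pair_pre_digraph" where
  "commuting_graph G =
     (let V = carrier G - group_center G in
      \<lparr>pverts = V,
       parcs = {(x, y) \<in> V \<times> V. x \<noteq> y \<and> x \<otimes>\<^bsub>G\<^esub> y = y \<otimes>\<^bsub>G\<^esub> x}\<rparr>)"

lemma pair_bidirected_digraph_commuting_graph: "pair_bidirected_digraph (commuting_graph G)"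
  by unfold_locales (auto simp: commuting_graph_def Let_def symmetric_def intro!: symI)

lemma pair_graph_commuting_graph:
  assumes "finite (carrier G)"
  shows "pair_graph (commuting_graph G)"
proof -
  interpret pair_bidirected_digraph "commuting_graph G"
    by (rule pair_bidirected_digraph_commuting_graph)
  have "finite (pverts (commuting_graph G))"
    using assms by (simp add: commuting_graph_def Let_def)
  moreover have "parcs (commuting_graph G) \<subseteq> pverts (commuting_graph G) \<times> pverts (commuting_graph G)"
    by (auto simp: commuting_graph_def Let_def)
  ultimately show ?thesis
    by unfold_locales (auto intro: finite_subset)
qed

lemma graph_dist_eq_path_length:
  assumes "wf_digraph G"
  shows "graph_dist G u v = (INF p\<in>{p. pre_digraph.apath G u p v}. ereal (real (length p)))"
proof -
  interpret wf_digraph G by fact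
  have len: "awalk_cost (\<lambda>_. 1) p = real (length p)" for p
    by (induction p) simp_all
  have ge: "(INF p\<in>{p. apath u p v}. ereal (awalk_cost (\<lambda>_. 1) p)) \<le> ereal (awalk_cost (\<lambda>_. 1) p)"
    if p: "awalk u p v" for p
  proof (rule ccontr)
    assume "\<not> ?thesis"
    then obtain w q where "awalk w q w" "awalk_cost (\<lambda>_. 1) q < 0"
      using walk_cheaper_path_imp_neg_cyc[OF p, of "\<lambda>_. 1"] by (auto simp: not_le)
    then show False
      by (simp add: len)
  qed
  have "graph_dist G u v = (INF p\<in>{p. apath u p v}. ereal (awalk_cost (\<lambda>_. 1) p))"
    unfolding graph_dist_def \<mu>_def
    by (intro antisym INF_greatest ge INF_superset_mono) (auto simp: apath_def)
  then show ?thesis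
    by (simp add: len)
qed

end

theory Submission
  imports Defs
begin

text \<open>Every element of the wreath product commutes with some \<open>g\<close> in the base group whose first
  coordinate is nontrivial, and such a \<open>g\<close> commutes with the element that agrees with it in the first
  coordinate and is trivial elsewhere. Two elements concentrated in the first coordinate both commute
  with any element concentrated in the second. Hence any two vertices are joined by a walk of length
  \<open>2 + 2 + 2\<close>; nontrivial elements of the base group are vertices because \<open>A\<close> has trivial centre.\<close>

section \<open>Walks in commuting graphs\<close>

definition commuting_rel :: "('a, 'm) monoid_scheme \<Rightarrow> ('a \<times> 'a) set" where
  "commuting_rel G = {(x, y). x \<in> carrier G - group_center G \<and> y \<in> carrier G - group_center G \<and>
     x \<otimes>\<^bsub>G\<^esub> y = y \<otimes>\<^bsub>G\<^esub> x}"

text \<open>\<^const>\<open>commuting_rel\<close> is reflexive on the vertices while the graph has no loops, so only an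
  upper bound on the length is obtained.\<close>
lemma relpow_commuting_rel_imp_awalk:
  assumes "(x, y) \<in> commuting_rel G ^^ m" and "x \<in> carrier G - group_center G"
  shows "\<exists>p. pre_digraph.awalk (with_proj (commuting_graph G)) x p y \<and> length p \<le> m"
  using assms(1)
proof (induction m arbitrary: y)
  interpret pair_bidirected_digraph "commuting_graph G"
    by (rule pair_bidirected_digraph_commuting_graph)
  case 0
  then have "awalk x [] y"
    using assms(2) by (simp add: awalk_Nil_iff) (simp add: commuting_graph_def)
  then show ?case by auto
next
  interpret pair_bidirected_digraph "commuting_graph G"
    by (rule pair_bidirected_digraph_commuting_graph)
  case (Suc m)
  then obtain z where z: "(x, z) \<in> commuting_rel G ^^ m" "(z, y) \<in> commuting_rel G"
    by auto
  with Suc.IH obtain p where p: "awalk x p z" "length p \<le> m"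
    by blast
  show ?case
  proof (cases "z = y")
    case True
    then show ?thesis using p by auto
  next
    case False
    then have "(z, y) \<in> parcs (commuting_graph G)"
      using z(2) by (auto simp: commuting_graph_def commuting_rel_def Let_def)
    then have "awalk z [(z, y)] y"
      using arc_implies_awalk[of "(z, y)"] by simp
    then have "awalk x (p @ [(z, y)]) y"
      using p(1) by (rule awalk_appendI[rotated])
    then show ?thesis
      using p(2) by (intro exI[of _ "p @ [(z, y)]"]) simp
  qed
qed

text \<open>Reduces connectedness and the diameter bound to composing powers of
  \<open>commuting_rel\<close>. A nonempty vertex set is part of the notion of
  connectedness.\<close>

lemma commuting_graph_connected_diameter_le:
  assumes "carrier G - group_center G \<noteq> {}"
    and rel: "\<And>x y. x \<in> carrier G - group_center G \<Longrightarrow> y \<in> carrier G - group_center G \<Longrightarrow>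
               (x, y) \<in> commuting_rel G ^^ m"
  shows "Digraph_Component.connected (with_proj (commuting_graph G))"
    and "graph_diameter (with_proj (commuting_graph G)) \<le> ereal (real m)"
proof -
  interpret pair_bidirected_digraph "commuting_graph G"
    by (rule pair_bidirected_digraph_commuting_graph)
  have verts: "pverts (commuting_graph G) = carrier G - group_center G"
    by (simp add: commuting_graph_def Let_def)
  have walk: "\<exists>p. awalk x p y \<and> length p \<le> m"
    if "x \<in> pverts (commuting_graph G)" "y \<in> pverts (commuting_graph G)" for x y
    using relpow_commuting_rel_imp_awalk[OF rel[of x y]] that verts by simp
  have "x \<rightarrow>\<^sup>*\<^bsub>with_proj (commuting_graph G)\<^esub> y"
    if "x \<in> pverts (commuting_graph G)" "y \<in> pverts (commuting_graph G)" for x y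
    using walk[OF that] by (auto simp: reachable_awalk)
  then show "Digraph_Component.connected (with_proj (commuting_graph G))"
    using assms(1) by (intro connectedI) (auto simp: verts reachable_mk_symmetricI)
  have "graph_dist (with_proj (commuting_graph G)) x y \<le> ereal (real m)"
    if xy: "x \<in> pverts (commuting_graph G)" "y \<in> pverts (commuting_graph G)" for x y
  proof -
    have len: "awalk_cost (\<lambda>_. 1) p = real (length p)" for p
      by (induction p) simp_all
    obtain p where p: "awalk x p y" "length p \<le> m"
      using walk xy by blast
    have "graph_dist (with_proj (commuting_graph G)) x y \<le> ereal (awalk_cost (\<lambda>_. 1) p)"
      unfolding graph_dist_def by (rule min_cost_le_walk_cost[OF p(1)])
    also have "\<dots> \<le> ereal (real m)"
      using p(2) by (simp add: len)
    finally show ?thesis .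
  qed
  then show "graph_diameter (with_proj (commuting_graph G)) \<le> ereal (real m)"
    unfolding graph_diameter_def by (auto intro!: SUP_least)
qed

section \<open>Elements of the base group\<close>

text \<open>The embedding of \<open>A\<close> as the \<open>k\<close>-th factor of the base
  group.\<close>

definition single_coord :: "('a, 'm) monoid_scheme \<Rightarrow> nat \<Rightarrow> nat \<Rightarrow> 'a \<Rightarrow> nat \<Rightarrow> 'a" where
  "single_coord A n k a = (\<lambda>i\<in>{1..n}. if i = k then a else \<one>\<^bsub>A\<^esub>)"

lemma single_coord_in_PiE:
  assumes "group A" "a \<in> carrier A"
  shows "single_coord A n k a \<in> {1..n} \<rightarrow>\<^sub>E carrier A"
  using assms by (auto simp: single_coord_def group.is_monoid)

lemma carrier_wreath_product_sym_group:
  "carrier (wreath_product A n (carrier (sym_group n))) =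
     ({1..n} \<rightarrow>\<^sub>E carrier A) \<times> {\<sigma>. \<sigma> permutes {1..n}}"
  by (auto simp: wreath_product_def semidirect_product_def sym_group_def)

lemma base_in_carrier_wreath_product:
  "f \<in> {1..n} \<rightarrow>\<^sub>E carrier A \<Longrightarrow> (f, id) \<in> carrier (wreath_product A n (carrier (sym_group n)))"
  by (simp add: carrier_wreath_product_sym_group)

text \<open>Multiplying \<open>(f, \<sigma>)\<close> by \<open>(g, id)\<close> on the right reads
  \<open>g\<close> at \<open>inv \<sigma> i\<close>, while the other order leaves \<open>f\<close>
  unmoved; substituting \<open>\<sigma> i\<close> for \<open>i\<close> removes the inverse.\<close>

lemma wreath_product_commute_base_iff:
  assumes \<sigma>: "\<sigma> permutes {1..n}"
  shows "(f, \<sigma>) \<otimes>\<^bsub>wreath_product A n H\<^esub> (g, id) = (g, id) \<otimes>\<^bsub>wreath_product A n H\<^esub> (f, \<sigma>) \<longleftrightarrow>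
    (\<forall>i\<in>{1..n}. f (\<sigma> i) \<otimes>\<^bsub>A\<^esub> g i = g (\<sigma> i) \<otimes>\<^bsub>A\<^esub> f (\<sigma> i))"
    (is "?L \<longleftrightarrow> ?R")
proof -
  have "?L \<longleftrightarrow> (\<forall>i\<in>{1..n}. f i \<otimes>\<^bsub>A\<^esub> g (Hilbert_Choice.inv \<sigma> i) = g i \<otimes>\<^bsub>A\<^esub> f i)"
    by (auto simp: wreath_product_def semidirect_product_def sym_group_def permute_coords_def
        restrict_def fun_eq_iff)
  also have "\<dots> \<longleftrightarrow> (\<forall>i\<in>\<sigma> ` {1..n}. f i \<otimes>\<^bsub>A\<^esub> g (Hilbert_Choice.inv \<sigma> i) = g i \<otimes>\<^bsub>A\<^esub> f i)"
    by (simp only: permutes_image[OF \<sigma>])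
  also have "\<dots> \<longleftrightarrow> ?R"
    by (simp add: permutes_inverses(2)[OF \<sigma>])
  finally show ?thesis .
qed

text \<open>For \<open>\<sigma> = id\<close> the criterion is coordinatewise, and away from
  \<open>k\<close> one of the two entries is trivial.\<close>

lemma base_commute_single_coord_iff:
  assumes "group A" "g \<in> {1..n} \<rightarrow>\<^sub>E carrier A" "k \<in> {1..n}"
  shows "(g, id) \<otimes>\<^bsub>wreath_product A n H\<^esub> (single_coord A n k a, id) =
      (single_coord A n k a, id) \<otimes>\<^bsub>wreath_product A n H\<^esub> (g, id) \<longleftrightarrow>
    g k \<otimes>\<^bsub>A\<^esub> a = a \<otimes>\<^bsub>A\<^esub> g k"
proof -
  interpret group A by fact
  have "g i \<in> carrier A" if "i \<in> {1..n}" for i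
    using assms(2) that by auto
  then show ?thesis
    using assms(3) by (auto simp: wreath_product_commute_base_iff permutes_id single_coord_def)
qed

text \<open>Since \<open>g k\<close> is not central in \<open>A\<close>, some \<open>b\<close> fails
  to commute with it; placing \<open>b\<close> in coordinate \<open>k\<close> gives a witness in the
  wreath product.\<close>

lemma base_notin_center:
  assumes "group A" and Z: "group_center A = {\<one>\<^bsub>A\<^esub>}"
    and g: "g \<in> {1..n} \<rightarrow>\<^sub>E carrier A" and k: "k \<in> {1..n}" "g k \<noteq> \<one>\<^bsub>A\<^esub>"
  shows "(g, id) \<notin> group_center (wreath_product A n (carrier (sym_group n)))"
proof -
  have "g k \<in> carrier A - group_center A"
    using g k Z by auto
  then obtain b where "b \<in> carrier A" "g k \<otimes>\<^bsub>A\<^esub> b \<noteq> b \<otimes>\<^bsub>A\<^esub> g k"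
    by (auto simp: group_center_def)
  then show ?thesis
    using base_commute_single_coord_iff[OF assms(1) g k(1)]
      base_in_carrier_wreath_product[OF single_coord_in_PiE[OF assms(1)]]
    unfolding group_center_def by blast
qed

lemma exists_commuting_nontrivial:
  assumes "group A" and "carrier A \<noteq> {\<one>\<^bsub>A\<^esub>}" and d: "d \<in> carrier A"
  obtains a where "a \<in> carrier A" "a \<noteq> \<one>\<^bsub>A\<^esub>" "d \<otimes>\<^bsub>A\<^esub> a = a \<otimes>\<^bsub>A\<^esub> d"
proof (cases "d = \<one>\<^bsub>A\<^esub>")
  case True
  interpret group A by fact
  obtain a where "a \<in> carrier A" "a \<noteq> \<one>\<^bsub>A\<^esub>"
    using assms(2) one_closed by blast
  then show thesis using True that by auto
next
  case False
  then show thesis using d that by blast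
qed

text \<open>Fix a point \<open>s\<close> whose \<open>\<sigma>\<close>-cycle has length \<open>k\<close>. Commuting with \<open>(f, \<sigma>)\<close> means
  \<open>g (\<sigma> i) = t i \<otimes> g i \<otimes> inv (t i)\<close> with \<open>t i = f (\<sigma> i)\<close>, which determines \<open>g\<close> on the cycle from
  \<open>a = g s\<close>. Going once around the cycle is consistent iff \<open>a\<close> commutes with the cycle product
  \<open>P k\<close>.\<close>
lemma exists_commuting_base:
  assumes A: "group A" and nontriv: "carrier A \<noteq> {\<one>\<^bsub>A\<^esub>}"
    and f: "f \<in> {1..n} \<rightarrow>\<^sub>E carrier A" and \<sigma>: "\<sigma> permutes {1..n}" and s: "s \<in> {1..n}"
  obtains g where "g \<in> {1..n} \<rightarrow>\<^sub>E carrier A" "g s \<noteq> \<one>\<^bsub>A\<^esub>"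
    "(f, \<sigma>) \<otimes>\<^bsub>wreath_product A n H\<^esub> (g, id) = (g, id) \<otimes>\<^bsub>wreath_product A n H\<^esub> (f, \<sigma>)"
proof -
  interpret group A by fact
  define t where "t i = f (\<sigma> i)" for i
  have \<sigma>_in: "\<sigma> i \<in> {1..n} \<longleftrightarrow> i \<in> {1..n}" for i
    using permutes_in_image[OF \<sigma>] .
  have t: "t i \<in> carrier A" if "i \<in> {1..n}" for i
    using f \<sigma>_in that by (auto simp: t_def)
  have orbit_in: "(\<sigma> ^^ j) s \<in> {1..n}" for j
    using permutes_in_image[OF permutes_funpow[OF \<sigma>]] s by blast
  define k where "k = (LEAST m. m > 0 \<and> (\<sigma> ^^ m) s = s)"
  have "\<exists>m. m > 0 \<and> (\<sigma> ^^ m) s = s"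
    using permutation_self[of \<sigma> s] permutation_permutes \<sigma> by (metis finite_atLeastAtMost)
  then have k: "k > 0" "(\<sigma> ^^ k) s = s"
    unfolding k_def by (metis (mono_tags, lifting) LeastI_ex)+
  have k_min: "(\<sigma> ^^ m) s \<noteq> s" if "0 < m" "m < k" for m
    using not_less_Least[of m "\<lambda>m. m > 0 \<and> (\<sigma> ^^ m) s = s"] that by (auto simp: k_def)
  \<comment> \<open>Each point of the cycle then has a unique index below \<open>k\<close>, so that
    \<open>g\<close> can be defined through that index.\<close>
  have inj: "inj_on (\<lambda>j. (\<sigma> ^^ j) s) {..<k}"
  proof (rule linorder_inj_onI)
    fix i j assume ij: "i < j" "i \<in> {..<k}" "j \<in> {..<k}"
    show "(\<sigma> ^^ i) s \<noteq> (\<sigma> ^^ j) s"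
    proof
      assume "(\<sigma> ^^ i) s = (\<sigma> ^^ j) s"
      also have "(\<sigma> ^^ j) s = (\<sigma> ^^ i) ((\<sigma> ^^ (j - i)) s)"
        using ij(1) funpow_add[of i "j - i" \<sigma>] by simp
      finally have "(\<sigma> ^^ (j - i)) s = s"
        using permutes_inj[OF permutes_funpow[OF \<sigma>]] by (metis injD)
      then show False using k_min[of "j - i"] less_imp_diff_less[of j k i] ij by auto
    qed
  qed auto
  define P where "P = rec_nat \<one>\<^bsub>A\<^esub> (\<lambda>j q. t ((\<sigma> ^^ j) s) \<otimes>\<^bsub>A\<^esub> q)"
  have P_0: "P 0 = \<one>\<^bsub>A\<^esub>" and P_Suc: "P (Suc j) = t ((\<sigma> ^^ j) s) \<otimes>\<^bsub>A\<^esub> P j" for j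
    by (simp_all add: P_def)
  have P: "P j \<in> carrier A" for j
    by (induction j) (use t orbit_in in \<open>auto simp: P_0 P_Suc\<close>)
  obtain a where a: "a \<in> carrier A" "a \<noteq> \<one>\<^bsub>A\<^esub>" "P k \<otimes>\<^bsub>A\<^esub> a = a \<otimes>\<^bsub>A\<^esub> P k"
    using exists_commuting_nontrivial[OF A nontriv P] .
  define C where "C = (\<lambda>j. (\<sigma> ^^ j) s) ` {..<k}"
  \<comment> \<open>The value forced at the \<open>j\<close>-th point of the cycle:
    \<open>P j\<close> accumulates the conjugators of the first \<open>j\<close> steps.\<close>
  define c where "c j = P j \<otimes>\<^bsub>A\<^esub> a \<otimes>\<^bsub>A\<^esub> inv\<^bsub>A\<^esub> P j" for j
  have c: "c j \<in> carrier A" for j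
    using P a by (simp add: c_def)
  have c_0: "c 0 = a"
    using a by (simp add: c_def P_0)
  have c_k: "c k = a"
    using a P by (simp add: c_def inv_solve_right')
  have c_Suc: "t ((\<sigma> ^^ j) s) \<otimes>\<^bsub>A\<^esub> c j = c (Suc j) \<otimes>\<^bsub>A\<^esub> t ((\<sigma> ^^ j) s)" for j
    using t[OF orbit_in, of j] P a(1) by (simp add: c_def P_Suc inv_mult_group m_assoc)
  \<comment> \<open>Off the cycle the default is the identity, which satisfies the commutation
    equations there.\<close>
  define g where "g = (\<lambda>i\<in>{1..n}. if i \<in> C
    then c (the_inv_into {..<k} (\<lambda>j. (\<sigma> ^^ j) s) i) else \<one>\<^bsub>A\<^esub>)"
  have g_orbit: "g ((\<sigma> ^^ j) s) = c j" if "j < k" for j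
    using that orbit_in the_inv_into_f_f[OF inj, of j] by (auto simp: g_def C_def)
  \<comment> \<open>The case \<open>j = k\<close> is the return to \<open>s\<close>, where
    \<open>c k = a = c 0\<close>. It is needed because the step from index \<open>k - 1\<close> ends
    there.\<close>
  have g_orbit': "g ((\<sigma> ^^ j) s) = c j" if "j \<le> k" for j
    using that g_orbit[of j] g_orbit[of 0] k c_0 c_k by (cases "j = k") auto
  have g: "g \<in> {1..n} \<rightarrow>\<^sub>E carrier A"
    using c by (auto simp: g_def)
  have "f (\<sigma> i) \<otimes>\<^bsub>A\<^esub> g i = g (\<sigma> i) \<otimes>\<^bsub>A\<^esub> f (\<sigma> i)" if i: "i \<in> {1..n}" for i
  proof (cases "i \<in> C")
    case True
    then obtain j where j: "j < k" "i = (\<sigma> ^^ j) s"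
      by (auto simp: C_def)
    then have "\<sigma> i = (\<sigma> ^^ Suc j) s"
      by simp
    then have "g (\<sigma> i) = c (Suc j)"
      using g_orbit'[of "Suc j"] j(1) by simp
    then show ?thesis
      using c_Suc[of j] g_orbit[OF j(1)] j(2) by (simp add: t_def)
  next
    case False
    \<comment> \<open>The complement of the cycle is stable under \<open>\<sigma>\<close>, so
      \<open>g\<close> is trivial at both \<open>i\<close> and \<open>\<sigma> i\<close>.\<close>
    have "\<sigma> i \<notin> C"
    proof
      assume "\<sigma> i \<in> C"
      then obtain j where j: "j < k" "\<sigma> i = (\<sigma> ^^ j) s"
        by (auto simp: C_def)
      \<comment> \<open>The predecessor on the cycle; for \<open>j = 0\<close> it wraps around to
        \<open>m = k - 1\<close>.\<close>
      obtain m where m: "m < k" "(\<sigma> ^^ j) s = (\<sigma> ^^ Suc m) s"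
        using j(1) k by (cases j) (metis Suc_pred' funpow_0 lessI, metis Suc_lessD)
      then have "i = (\<sigma> ^^ m) s"
        using j(2) permutes_inj[OF \<sigma>] by (auto dest: injD)
      then show False
        using False m(1) by (auto simp: C_def)
    qed
    then show ?thesis
      using False t[OF i] i \<sigma>_in[of i] by (auto simp: g_def t_def)
  qed
  then have "(f, \<sigma>) \<otimes>\<^bsub>wreath_product A n H\<^esub> (g, id) = (g, id) \<otimes>\<^bsub>wreath_product A n H\<^esub> (f, \<sigma>)"
    by (simp add: wreath_product_commute_base_iff[OF \<sigma>])
  moreover have "g s \<noteq> \<one>\<^bsub>A\<^esub>"
    using g_orbit[of 0] k(1) c_0 a(2) by simp
  ultimately show thesis
    using that g by blast
qed

section \<open>The commuting graph of the wreath product\<close>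

text \<open>Supplies both end segments of the walk: one leads from the starting vertex into the
  first factor, the other from the first factor to the final vertex.\<close>

lemma wreath_product_commuting_rel_single_coord:
  assumes A: "group A" and Z: "group_center A = {\<one>\<^bsub>A\<^esub>}" and nontriv: "carrier A \<noteq> {\<one>\<^bsub>A\<^esub>}"
    and n: "n \<ge> 1"
    and x: "x \<in> carrier (wreath_product A n (carrier (sym_group n))) -
              group_center (wreath_product A n (carrier (sym_group n)))"
  obtains a where "a \<in> carrier A" "a \<noteq> \<one>\<^bsub>A\<^esub>"
    "(x, (single_coord A n 1 a, id)) \<in> commuting_rel (wreath_product A n (carrier (sym_group n))) ^^ 2"
    "((single_coord A n 1 a, id), x) \<in> commuting_rel (wreath_product A n (carrier (sym_group n))) ^^ 2"
proof -
  let ?W = "wreath_product A n (carrier (sym_group n))"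
  have one: "1 \<in> {1..n}" using n by simp
  obtain f \<sigma> where fs: "x = (f, \<sigma>)" "f \<in> {1..n} \<rightarrow>\<^sub>E carrier A" "\<sigma> permutes {1..n}"
    using x by (auto simp: carrier_wreath_product_sym_group)
  obtain g where g: "g \<in> {1..n} \<rightarrow>\<^sub>E carrier A" "g 1 \<noteq> \<one>\<^bsub>A\<^esub>"
    "(f, \<sigma>) \<otimes>\<^bsub>?W\<^esub> (g, id) = (g, id) \<otimes>\<^bsub>?W\<^esub> (f, \<sigma>)"
    using exists_commuting_base[OF A nontriv fs(2,3) one] .
  \<comment> \<open>Reusing the entry \<open>g 1\<close> makes the commutation with
    \<open>(g, id)\<close> trivial, as \<open>g 1\<close> commutes with itself.\<close>
  let ?b = "(single_coord A n 1 (g 1), id)"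
  have g1: "g 1 \<in> carrier A" using g(1) one by auto
  note b = single_coord_in_PiE[OF A g1, of n 1]
  have "(g, id) \<in> carrier ?W - group_center ?W"
    using base_in_carrier_wreath_product[OF g(1)] base_notin_center[OF A Z g(1) one g(2)] by simp
  moreover have "?b \<in> carrier ?W - group_center ?W"
    using base_in_carrier_wreath_product[OF b] base_notin_center[OF A Z b one] g(2) one
    by (simp add: single_coord_def)
  moreover have "(g, id) \<otimes>\<^bsub>?W\<^esub> ?b = ?b \<otimes>\<^bsub>?W\<^esub> (g, id)"
    by (simp only: base_commute_single_coord_iff[OF A g(1) one])
  ultimately have "(x, (g, id)) \<in> commuting_rel ?W" "((g, id), ?b) \<in> commuting_rel ?W"
    "((g, id), x) \<in> commuting_rel ?W" "(?b, (g, id)) \<in> commuting_rel ?W"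
    using x g(3) fs(1) by (simp_all add: commuting_rel_def)
  then have "(x, ?b) \<in> commuting_rel ?W ^^ 2" "(?b, x) \<in> commuting_rel ?W ^^ 2"
    by (auto simp: numeral_2_eq_2)
  then show thesis using that g1 g(2) by blast
qed

theorem theorem1p1:
  fixes A :: "('a, 'm) monoid_scheme" and n :: nat
  assumes "n \<ge> 2"
    and "group A"
    and "finite (carrier A)"
    and "even (order A)"
    and "group_center A = {\<one>\<^bsub>A\<^esub>}"
    and "\<And>p :: nat. prime p \<Longrightarrow> p \<noteq> 2 \<Longrightarrow> p dvd order A \<Longrightarrow>
           card {C \<in> conjugacy_classes A. \<forall>x\<in>C. group.ord A x = p} < n"
  shows "Digraph_Component.connected
             (with_proj (commuting_graph (wreath_product A n (carrier (sym_group n))))) \<and>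
         graph_diameter
             (with_proj (commuting_graph (wreath_product A n (carrier (sym_group n))))) \<le> 7"
proof -
  let ?W = "wreath_product A n (carrier (sym_group n))"
  let ?R = "commuting_rel ?W"
  \<comment> \<open>The trivial group has odd order 1.\<close>
  have nontriv: "carrier A \<noteq> {\<one>\<^bsub>A\<^esub>}"
    using assms(4) by (auto simp: order_def)
  interpret group A by fact
  obtain a0 where a0: "a0 \<in> carrier A" "a0 \<noteq> \<one>\<^bsub>A\<^esub>"
    using nontriv one_closed by blast
  have vertex: "(single_coord A n i a, id) \<in> carrier ?W - group_center ?W"
    if "a \<in> carrier A" "a \<noteq> \<one>\<^bsub>A\<^esub>" "i \<in> {1..n}" for a i
    using base_in_carrier_wreath_product[OF single_coord_in_PiE[OF assms(2) that(1)]]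
      base_notin_center[OF assms(2,5) single_coord_in_PiE[OF assms(2) that(1)] that(3)] that
    by (simp add: single_coord_def)
  have comm: "((single_coord A n i a, id), (single_coord A n j b, id)) \<in> ?R"
    if "a \<in> carrier A" "a \<noteq> \<one>\<^bsub>A\<^esub>" "b \<in> carrier A" "b \<noteq> \<one>\<^bsub>A\<^esub>" "i \<in> {1..n}" "j \<in> {1..n}" "i \<noteq> j"
    for a b i j
    using vertex[OF that(1,2,5)] vertex[OF that(3,4,6)]
      base_commute_single_coord_iff[OF assms(2) single_coord_in_PiE[OF assms(2) that(1)] that(6)] that
    by (simp add: commuting_rel_def single_coord_def)
  have coords: "1 \<in> {1..n}" "2 \<in> {1..n}" "(1 :: nat) \<noteq> 2"
    using assms(1) by auto
  have rel: "(x, y) \<in> ?R ^^ 6"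
    if x: "x \<in> carrier ?W - group_center ?W" and y: "y \<in> carrier ?W - group_center ?W" for x y
  proof -
    obtain a where a: "a \<in> carrier A" "a \<noteq> \<one>\<^bsub>A\<^esub>" "(x, (single_coord A n 1 a, id)) \<in> ?R ^^ 2"
      using wreath_product_commuting_rel_single_coord[OF assms(2,5) nontriv _ x] assms(1) by force
    obtain b where b: "b \<in> carrier A" "b \<noteq> \<one>\<^bsub>A\<^esub>" "((single_coord A n 1 b, id), y) \<in> ?R ^^ 2"
      using wreath_product_commuting_rel_single_coord[OF assms(2,5) nontriv _ y] assms(1) by force
    \<comment> \<open>The entries \<open>a\<close> and \<open>b\<close> need not commute, so the
      walk passes through \<open>a0\<close> in the second coordinate, which exists as
      \<open>n \<ge> 2\<close>.\<close>
    have "((single_coord A n 1 a, id), (single_coord A n 1 b, id)) \<in> ?R ^^ 2"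
      using comm[OF a(1,2) a0 coords] comm[OF a0 b(1,2) coords(2,1)]
      by (auto simp: numeral_2_eq_2)
    then have "(x, y) \<in> ?R ^^ 2 O ?R ^^ 2 O ?R ^^ 2"
      using a(3) b(3) by blast
    also have "?R ^^ 2 O ?R ^^ 2 O ?R ^^ 2 = ?R ^^ 6"
      by (simp flip: relpow_add)
    finally show ?thesis .
  qed
  have "carrier ?W - group_center ?W \<noteq> {}"
    using vertex[OF a0 coords(1)] by blast
  note diam = commuting_graph_connected_diameter_le[OF this rel]
  \<comment> \<open>The walks constructed give the stronger bound 6.\<close>
  have "graph_diameter (with_proj (commuting_graph ?W)) \<le> 7"
    using diam(2) by (rule order_trans) auto
  with diam(1) show ?thesis by blast
qed

end
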